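(* Let $m\ge2$ be an integer, $c\ge0$ and $\alpha>-1$. The even and odd eigenfunctions of $\mathcal{L}_{c,\alpha}$ are orthogonal, i.e. $$\int_{B(1)}\overline{\psi_{2N,m,\alpha}^{k,c,i}(x)}\,\psi_{2N'+1,m,\alpha}^{k',c,i'}(x)\,(1-|x|^2)^\alpha\,dx=0$$ for all $N,N'\ge0$, $k,k'\ge0$, $1\le i\le d_{k,m}$, $1\le i'\le d_{k',m}$.
   Context: $\mathbb{R}_m$ is the real Clifford algebra generated by $e_1,\dots,e_m$ with $e_j^2=-1$ and $e_ie_j=-e_je_i$ for $i\neq j$. A point of $\mathbb{R}^m$ is identified with the Clifford vector $x=\sum_{j=1}^m e_jx_j$. Hermitian conjugation $\lambda\mapsto\bar\lambda$ satisfies $\overline{\lambda\mu}=\bar\mu\bar\lambda$, $\overline{e_j}=-e_j$. The Dirac operator is $\partial_x f=\sum_{j=1}^m e_j\,\partial f/\partial x_j$. $M_l^+(k)$ is the set of homogeneous polynomials $Y_k:\mathbb{R}^m\to\mathbb{R}_m$ of degree $k$ with $\partial_xY_k=0$, of dimension $d_{k,m}=\binom{m+k-2}{k}$ (as a right Clifford module); for each $k$, $\{Y_k^i\}_{i=1}^{d_{k,m}}$ is an orthonormal basis of $M_l^+(k)$, i.e. $\int_{S^{m-1}}\overline{Y_k^i(\omega)}Y_k^{i'}(\omega)\,d\omega=\delta_{ii'}$. $B(1)$ is the unit ball of $\mathbb{R}^m$. The weighted Clifford prolate spheroidal wave functions (weighted CPSWFs) are the eigenfunctions on $B(1)$ of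 $$\mathcal{L}_{c,\alpha}f(x)=(1-|x|^2)^{-\alpha}\,\partial_x\big((1-|x|^2)^{\alpha+1}\,\partial_xf(x)\big)+4\pi^2c^2|x|^2f(x).$$ The even ones attached to $Y_k^i$ are the eigenfunctions of the form $F(|x|^2)Y_k^i(x)$, and the odd ones those of the form $G(|x|^2)\,x\,Y_k^i(x)$, with $F,G\in C^\infty([0,1],\mathbb{R})$ not identically zero (the admissible $F$, $G$ and eigenvalues do not depend on $i$). In each case they are enumerated, up to nonzero real scalar multiples, by $N=0,1,2,\dots$ in order of increasing eigenvalue, and written $\psi_{2N,m,\alpha}^{k,c,i}(x)=P_{N,m,\alpha}^{k,c}(|x|^2)Y_k^i(x)$ and $\psi_{2N+1,m,\alpha}^{k,c,i}(x)=Q_{N,m,\alpha}^{k,c}(|x|^2)\,x\,Y_k^i(x)$. *)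

theory Defs
  imports "HOL-Analysis.Analysis"
begin

section \<open>The real Clifford algebra of dimension \<open>2 ^ CARD('n)\<close>\<close>

text \<open>
  The generators \<open>e_j\<close> are indexed by a finite linearly ordered type \<open>'n\<close>, and an
  element of the algebra is given by its coordinates in the basis
  \<open>e_A = e_j1 \<dots> e_jr\<close>, where \<open>A = {j1 < \<dots> < jr}\<close>.  The Clifford product is
  \<open>\<odot>\<close>; the product \<open>*\<close> that the library puts on the type \<^typ>\<open>real^'i\<close> is
  the componentwise one and plays no role here.
\<close>

type_synonym 'n clifford = "real ^ ('n set)"
type_synonym 'n point = "(real, 'n) vec"

definition blade :: "'n::{finite,linorder} set \<Rightarrow> 'n clifford" where
  "blade A = axis A 1"

abbreviation clifford_one :: "'n::{finite,linorder} clifford" where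
  "clifford_one \<equiv> blade {}"

abbreviation gen :: "'n::{finite,linorder} \<Rightarrow> 'n clifford" where
  "gen j \<equiv> blade {j}"

text \<open>
  Sorting the word \<open>e_A e_B\<close> costs one sign for each pair \<open>a \<in> A\<close>, \<open>b \<in> B\<close> with
  \<open>b < a\<close> (anticommutation) and one for each pair with \<open>b = a\<close> (from \<open>e_a\<^sup>2 = -1\<close>).
\<close>

definition blade_sign :: "'n::{finite,linorder} set \<Rightarrow> 'n set \<Rightarrow> real" where
  "blade_sign A B = (\<Prod>a\<in>A. \<Prod>b\<in>B. if b \<le> a then -1 else 1)"

definition clifford_mult ::
    "'n::{finite,linorder} clifford \<Rightarrow> 'n clifford \<Rightarrow> 'n clifford"  (infixl \<open>\<odot>\<close> 70) where
  "u \<odot> v = (\<Sum>A\<in>UNIV. \<Sum>B\<in>UNIV. (u $ A * v $ B * blade_sign A B) *\<^sub>R blade (sym_diff A B))"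

text \<open>
  Reversing a word of length \<open>r\<close> gives the sign \<open>(-1) ^ (r (r - 1) / 2)\<close>, and
  negating each of its letters gives \<open>(-1) ^ r\<close>.
\<close>

definition clifford_conj :: "'n::{finite,linorder} clifford \<Rightarrow> 'n clifford" where
  "clifford_conj u = (\<chi> A. (-1) ^ (card A * (card A + 1) div 2) * u $ A)"

definition clifford_vec :: "'n::{finite,linorder} point \<Rightarrow> 'n clifford" where
  "clifford_vec x = (\<Sum>j\<in>UNIV. x $ j *\<^sub>R gen j)"

text \<open>
  The following facts show that \<open>\<odot>\<close> and \<^const>\<open>clifford_conj\<close> are the product and
  the conjugation of the Clifford algebra.
\<close>

lemma bilinear_clifford_mult:
  "bilinear (clifford_mult :: 'n::{finite,linorder} clifford \<Rightarrow> _)"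
  unfolding bilinear_def clifford_mult_def
  by (auto intro!: linearI simp: algebra_simps scaleR_sum_right sum.distrib)

lemma linear_clifford_conj:
  "linear (clifford_conj :: 'n::{finite,linorder} clifford \<Rightarrow> _)"
  by (rule linearI) (simp_all add: clifford_conj_def vec_eq_iff algebra_simps)

lemma blade_nth: "blade A $ B = (if B = A then 1 else 0)"
  by (simp add: blade_def axis_def)

lemma blade_mult: "blade A \<odot> blade B = blade_sign A B *\<^sub>R blade (sym_diff A B)"
proof -
  have inner: "(\<Sum>B'\<in>UNIV. (blade A $ A' * blade B $ B' * blade_sign A' B') *\<^sub>R blade (sym_diff A' B')) =
      (if A' = A then blade_sign A B *\<^sub>R blade (sym_diff A B) else 0)" for A'
  proof -
    have "(\<Sum>B'\<in>UNIV. (blade A $ A' * blade B $ B' * blade_sign A' B') *\<^sub>R blade (sym_diff A' B')) =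
      (\<Sum>B'\<in>UNIV. if B' = B then (if A' = A then blade_sign A B *\<^sub>R blade (sym_diff A B) else 0) else 0)"
      by (intro sum.cong refl) (simp add: blade_nth)
    then show ?thesis by simp
  qed
  show ?thesis unfolding clifford_mult_def inner by simp
qed

lemma clifford_expansion:
  fixes u :: "'n::{finite,linorder} clifford"
  shows "u = (\<Sum>A\<in>UNIV. u $ A *\<^sub>R blade A)"
  unfolding blade_def using basis_expansion[of u] by (simp add: scalar_mult_eq_scaleR)

lemma gen_square: "gen j \<odot> gen j = - clifford_one"
  by (simp add: blade_mult blade_sign_def)

lemma gen_anticommute: "i \<noteq> j \<Longrightarrow> gen i \<odot> gen j = - (gen j \<odot> gen i)"
  by (auto simp: blade_mult blade_sign_def Un_commute)

lemma blade_insert_greatest: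
  "\<forall>a\<in>A. a < j \<Longrightarrow> blade (insert j A) = blade A \<odot> gen j"
proof -
  assume *: "\<forall>a\<in>A. a < j"
  then have "blade_sign A {j} = 1"
    unfolding blade_sign_def by (intro prod.neutral) auto
  moreover have "sym_diff A {j} = insert j A" using * by auto
  ultimately show ?thesis by (simp add: blade_mult)
qed

lemma prod_sym_diff_sign:
  fixes f :: "'i::finite \<Rightarrow> real"
  assumes "\<And>i. f i * f i = 1"
  shows "prod f (sym_diff A B) = prod f A * prod f B"
proof -
  have A: "prod f A = prod f (A - B) * prod f (A \<inter> B)"
    by (subst prod.union_disjoint[symmetric]) (auto intro!: prod.cong)
  have B: "prod f B = prod f (B - A) * prod f (A \<inter> B)"
    by (subst prod.union_disjoint[symmetric]) (auto intro!: prod.cong)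
  have "prod f (A \<inter> B) * prod f (A \<inter> B) = 1"
    unfolding prod.distrib[symmetric] using assms by simp
  then have "prod f A * prod f B = prod f (A - B) * prod f (B - A)"
    unfolding A B by (metis (no_types, opaque_lifting) mult.assoc mult.commute mult.right_neutral)
  also have "\<dots> = prod f (sym_diff A B)"
    by (subst prod.union_disjoint) auto
  finally show ?thesis by simp
qed

lemma blade_sign_square: "blade_sign A B * blade_sign A B = 1"
  unfolding blade_sign_def prod.distrib[symmetric] by (intro prod.neutral ballI) auto

lemma blade_sign_sym_diff_left:
  "blade_sign (sym_diff A B) C = blade_sign A C * blade_sign B C"
  unfolding blade_sign_def
  by (rule prod_sym_diff_sign) (unfold prod.distrib[symmetric], intro prod.neutral ballI, auto)

lemma blade_sign_sym_diff_right:
  "blade_sign A (sym_diff B C) = blade_sign A B * blade_sign A C"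
  unfolding blade_sign_def prod.distrib[symmetric]
  by (intro prod.cong refl prod_sym_diff_sign) auto

lemma clifford_mult_sum_left: "sum f S \<odot> v = (\<Sum>i\<in>S. f i \<odot> v)"
  by (rule linear_sum) (use bilinear_clifford_mult in \<open>unfold bilinear_def, blast\<close>)

lemma clifford_mult_sum_right: "u \<odot> sum f S = (\<Sum>i\<in>S. u \<odot> f i)"
  by (rule linear_sum) (use bilinear_clifford_mult in \<open>unfold bilinear_def, blast\<close>)

lemma clifford_mult_scaleR_left: "(r *\<^sub>R u) \<odot> v = r *\<^sub>R (u \<odot> v)"
  using bilinear_lmul[OF bilinear_clifford_mult] .

lemma clifford_mult_scaleR_right: "u \<odot> (r *\<^sub>R v) = r *\<^sub>R (u \<odot> v)"
  using bilinear_rmul[OF bilinear_clifford_mult] .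

lemmas clifford_mult_linear = clifford_mult_sum_left clifford_mult_sum_right
  clifford_mult_scaleR_left clifford_mult_scaleR_right

lemma blade_mult_assoc: "(blade A \<odot> blade B) \<odot> blade C = blade A \<odot> (blade B \<odot> blade C)"
proof -
  have "sym_diff (sym_diff A B) C = sym_diff A (sym_diff B C)" by auto
  then show ?thesis
    by (simp only: blade_mult clifford_mult_linear blade_sign_sym_diff_left
        blade_sign_sym_diff_right scaleR_scaleR) (simp add: mult_ac)
qed

lemma clifford_mult_assoc: "(u \<odot> v) \<odot> w = u \<odot> (v \<odot> w)"
proof -
  have "((\<Sum>A\<in>UNIV. u $ A *\<^sub>R blade A) \<odot> (\<Sum>A\<in>UNIV. v $ A *\<^sub>R blade A)) \<odot>
        (\<Sum>A\<in>UNIV. w $ A *\<^sub>R blade A) =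
      (\<Sum>A\<in>UNIV. u $ A *\<^sub>R blade A) \<odot>
        ((\<Sum>A\<in>UNIV. v $ A *\<^sub>R blade A) \<odot> (\<Sum>A\<in>UNIV. w $ A *\<^sub>R blade A))"
    by (simp only: clifford_mult_linear blade_mult_assoc)
  then show ?thesis by (simp only: clifford_expansion[symmetric])
qed

lemma clifford_one_mult: "clifford_one \<odot> u = u"
proof -
  have "clifford_one \<odot> (\<Sum>A\<in>UNIV. u $ A *\<^sub>R blade A) = (\<Sum>A\<in>UNIV. u $ A *\<^sub>R blade A)"
    by (simp add: clifford_mult_linear blade_mult blade_sign_def)
  then show ?thesis by (simp only: clifford_expansion[symmetric])
qed

lemma clifford_mult_one: "u \<odot> clifford_one = u"
proof -
  have "(\<Sum>A\<in>UNIV. u $ A *\<^sub>R blade A) \<odot> clifford_one = (\<Sum>A\<in>UNIV. u $ A *\<^sub>R blade A)"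
    by (simp add: clifford_mult_linear blade_mult blade_sign_def)
  then show ?thesis by (simp only: clifford_expansion[symmetric])
qed

lemma blade_sign_self:
  fixes A :: "'n::{finite,linorder} set"
  shows "blade_sign A A = (-1) ^ (card A * (card A + 1) div 2)"
using finite[of A]
proof (induction A rule: finite_linorder_max_induct)
  case empty
  then show ?case by (simp add: blade_sign_def)
next
  case (insert b A)
  have b: "b \<notin> A" using insert by auto
  then have sd: "insert b A = sym_diff A {b}" by auto
  have 1: "blade_sign A {b} = 1"
    using insert unfolding blade_sign_def by (intro prod.neutral) auto
  have 2: "blade_sign {b} A = (-1) ^ card A"
  proof -
    have "blade_sign {b} A = (\<Prod>a\<in>A. - 1)"
      using insert.hyps unfolding blade_sign_def
      by (auto simp del: prod_constant intro!: prod.cong dest: less_imp_le)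
    then show ?thesis by simp
  qed
  have 3: "blade_sign {b} {b} = -1" by (simp add: blade_sign_def)
  have "blade_sign (insert b A) (insert b A) = blade_sign A A * (-1) ^ (card A + 1)"
    unfolding sd blade_sign_sym_diff_left blade_sign_sym_diff_right 1 2 3 by simp
  moreover have "card (insert b A) = card A + 1" using b by simp
  moreover have "(n + 1) * (n + 1 + 1) div 2 = n * (n + 1) div 2 + (n + 1)" for n :: nat
  proof -
    have "(n + 1) * (n + 1 + 1) = n * (n + 1) + (n + 1) * 2" by (simp add: algebra_simps)
    then show ?thesis by (metis div_mult_self1 zero_neq_numeral add.commute)
  qed
  ultimately show ?case using insert.IH by (simp add: power_add)
qed

lemma clifford_conj_blade: "clifford_conj (blade A) = blade_sign A A *\<^sub>R blade A"
  by (simp add: clifford_conj_def blade_def vec_eq_iff axis_def blade_sign_self)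

lemma clifford_conj_gen: "clifford_conj (gen j) = - gen j"
  by (simp add: clifford_conj_blade blade_sign_def)

lemma clifford_conj_mult: "clifford_conj (u \<odot> v) = clifford_conj v \<odot> clifford_conj u"
proof -
  have *: "clifford_conj (blade A \<odot> blade B) =
      clifford_conj (blade B) \<odot> clifford_conj (blade A)" for A B :: "'a set"
  proof -
    have "sym_diff B A = sym_diff A B" by auto
    moreover have "blade_sign A B * (blade_sign A A * blade_sign A B * (blade_sign B A * blade_sign B B))
       = blade_sign A A * (blade_sign B B * blade_sign B A)"
      using blade_sign_square[of A B] by algebra
    ultimately show ?thesis
      by (simp add: blade_mult linear_scale[OF linear_clifford_conj] clifford_conj_blade
          clifford_mult_linear blade_sign_sym_diff_left blade_sign_sym_diff_right mult_ac)
  qed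
  have "clifford_conj ((\<Sum>A\<in>UNIV. u $ A *\<^sub>R blade A) \<odot> (\<Sum>A\<in>UNIV. v $ A *\<^sub>R blade A)) =
      clifford_conj (\<Sum>A\<in>UNIV. v $ A *\<^sub>R blade A) \<odot> clifford_conj (\<Sum>A\<in>UNIV. u $ A *\<^sub>R blade A)"
    apply (simp only: clifford_mult_linear linear_sum[OF linear_clifford_conj]
        linear_scale[OF linear_clifford_conj] * scaleR_sum_right scaleR_scaleR)
    apply (subst sum.swap)
    apply (simp add: mult.commute)
    done
  then show ?thesis by (simp only: clifford_expansion[symmetric])
qed


section \<open>Dirac operator and spherical monogenics\<close>

definition partial_deriv ::
    "'n::finite \<Rightarrow> ('n point \<Rightarrow> 'a::real_normed_vector) \<Rightarrow> 'n point \<Rightarrow> 'a" where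
  "partial_deriv j f x = vector_derivative (\<lambda>t. f (x + t *\<^sub>R axis j 1)) (at 0)"

definition dirac ::
    "('n::{finite,linorder} point \<Rightarrow> 'n clifford) \<Rightarrow> 'n point \<Rightarrow> 'n clifford" where
  "dirac f x = (\<Sum>j\<in>UNIV. gen j \<odot> partial_deriv j f x)"

definition homogeneous_polynomial ::
    "nat \<Rightarrow> ('n::finite point \<Rightarrow> 'a::real_normed_vector) \<Rightarrow> bool" where
  "homogeneous_polynomial k f \<longleftrightarrow>
     (\<exists>a. \<forall>x. f x = (\<Sum>\<beta>\<in>{\<beta>::'n \<Rightarrow> nat. (\<Sum>j\<in>UNIV. \<beta> j) = k}. (\<Prod>j\<in>UNIV. x $ j ^ \<beta> j) *\<^sub>R a \<beta>))"

definition spherical_monogenics ::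
    "nat \<Rightarrow> ('n::{finite,linorder} point \<Rightarrow> 'n clifford) set" where
  "spherical_monogenics k = {Y. homogeneous_polynomial k Y \<and> (\<forall>x. dirac Y x = 0)}"

definition monogenic_dim :: "nat \<Rightarrow> nat \<Rightarrow> nat" where
  "monogenic_dim m k = (m + k - 2) choose k"

text \<open>
  Unnormalised surface measure of the unit sphere, through polar coordinates: the
  measure of \<open>A\<close> is \<open>DIM('a)\<close> times the Lebesgue measure of the cone
  \<open>{x. norm x < 1 \<and> x / norm x \<in> A}\<close>.
\<close>

definition sphere_measure :: "'a::euclidean_space measure" where
  "sphere_measure =
     distr (density lborel (\<lambda>x. ennreal (real DIM('a)) * indicator (ball 0 1) x)) borel sgn"

definition orthonormal_monogenic_basis ::
    "nat \<Rightarrow> (nat \<Rightarrow> 'n::{finite,linorder} point \<Rightarrow> 'n clifford) \<Rightarrow> bool" where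
  "orthonormal_monogenic_basis k Y \<longleftrightarrow>
     (let I = {1..monogenic_dim CARD('n) k} in
       (\<forall>i\<in>I. Y i \<in> spherical_monogenics k) \<and>
       (\<forall>Z\<in>spherical_monogenics k. \<exists>a. \<forall>x. Z x = (\<Sum>i\<in>I. Y i x \<odot> a i)) \<and>
       (\<forall>a. (\<forall>x. (\<Sum>i\<in>I. Y i x \<odot> a i) = 0) \<longrightarrow> (\<forall>i\<in>I. a i = 0)) \<and>
       (\<forall>i\<in>I. \<forall>i'\<in>I. (\<integral>\<omega>. clifford_conj (Y i \<omega>) \<odot> Y i' \<omega> \<partial>sphere_measure) =
                         (if i = i' then clifford_one else 0)))"


section \<open>Weighted Clifford prolate spheroidal wave functions\<close>

definition cpswf_operator ::
    "real \<Rightarrow> real \<Rightarrow> ('n::{finite,linorder} point \<Rightarrow> 'n clifford) \<Rightarrow> 'n point \<Rightarrow> 'n clifford" where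
  "cpswf_operator c \<alpha> f x =
     (1 - (norm x)\<^sup>2) powr (- \<alpha>) *\<^sub>R dirac (\<lambda>y. (1 - (norm y)\<^sup>2) powr (\<alpha> + 1) *\<^sub>R dirac f y) x
     + (4 * pi\<^sup>2 * c\<^sup>2 * (norm x)\<^sup>2) *\<^sub>R f x"

definition smooth_on_unit_interval :: "(real \<Rightarrow> real) \<Rightarrow> bool" where
  "smooth_on_unit_interval F \<longleftrightarrow>
     (\<exists>D. (\<forall>t\<in>{0..1}. D 0 t = F t) \<and>
          (\<forall>n. \<forall>t\<in>{0..1}. (D n has_real_derivative D (Suc n) t) (at t within {0..1})))"

definition radial_multiple ::
    "(real \<Rightarrow> real) \<Rightarrow> ('n::{finite,linorder} point \<Rightarrow> 'n clifford) \<Rightarrow> 'n point \<Rightarrow> 'n clifford" where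
  "radial_multiple F W x = F ((norm x)\<^sup>2) *\<^sub>R W x"

definition vec_multiple ::
    "('n::{finite,linorder} point \<Rightarrow> 'n clifford) \<Rightarrow> 'n point \<Rightarrow> 'n clifford" where
  "vec_multiple Y x = clifford_vec x \<odot> Y x"

definition eigen_profile ::
    "real \<Rightarrow> real \<Rightarrow> ('n::{finite,linorder} point \<Rightarrow> 'n clifford) \<Rightarrow> real \<Rightarrow> (real \<Rightarrow> real) \<Rightarrow> bool" where
  "eigen_profile c \<alpha> W \<mu> F \<longleftrightarrow>
     smooth_on_unit_interval F \<and> (\<exists>t\<in>{0..1}. F t \<noteq> 0) \<and>
     (\<forall>x\<in>ball 0 1. cpswf_operator c \<alpha> (radial_multiple F W) x = \<mu> *\<^sub>R radial_multiple F W x)"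

text \<open>
  \<open>P 0, P 1, \<dots>\<close> lists, in order of increasing eigenvalue and up to nonzero real
  multiples without omission or repetition, all \<open>F\<close> for which \<open>F(|x|\<^sup>2) W(x)\<close> is an
  eigenfunction.
\<close>

definition enumerates_eigen_profiles ::
    "real \<Rightarrow> real \<Rightarrow> ('n::{finite,linorder} point \<Rightarrow> 'n clifford) \<Rightarrow>
     (nat \<Rightarrow> real) \<Rightarrow> (nat \<Rightarrow> real \<Rightarrow> real) \<Rightarrow> bool" where
  "enumerates_eigen_profiles c \<alpha> W \<mu> P \<longleftrightarrow>
     (\<forall>N. eigen_profile c \<alpha> W (\<mu> N) (P N)) \<and> strict_mono \<mu> \<and>
     (\<forall>\<nu> F. eigen_profile c \<alpha> W \<nu> F \<longrightarrow>
        (\<exists>!N. \<exists>a. a \<noteq> 0 \<and> (\<forall>t\<in>{0..1}. F t = a * P N t)))"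

definition even_cpswf ::
    "(nat \<Rightarrow> real \<Rightarrow> real) \<Rightarrow> ('n::{finite,linorder} point \<Rightarrow> 'n clifford) \<Rightarrow>
     nat \<Rightarrow> 'n point \<Rightarrow> 'n clifford" where
  "even_cpswf P Y N = radial_multiple (P N) Y"

definition odd_cpswf ::
    "(nat \<Rightarrow> real \<Rightarrow> real) \<Rightarrow> ('n::{finite,linorder} point \<Rightarrow> 'n clifford) \<Rightarrow>
     nat \<Rightarrow> 'n point \<Rightarrow> 'n clifford" where
  "odd_cpswf Q Y N = radial_multiple (Q N) (vec_multiple Y)"

end

theory Submission
  imports Defs
begin

text \<open>
An even and an odd eigenfunction multiply to
\<open>conj(\<psi>) \<psi>' = w(|x|\<^sup>2) conj(Y) x Y'\<close>, where \<open>w\<close> is the product of the two profiles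
and \<open>Y\<close>, \<open>Y'\<close> are monogenic polynomials.  The integral vanishes because
\<open>conj(Y) x Y'\<close> is orthogonal to every radial function, and this is a form of
Cauchy's theorem: on a sphere \<open>x\<close> is normal to the surface, and the divergence of the field
with components \<open>conj(Y) e\<^sub>j Y'\<close> is \<open>conj(Y) (\<partial> Y') - conj(\<partial> Y) Y' = 0\<close>, so that
\<open>conj(Y) x Y'\<close> has mean \<open>0\<close> over each sphere about the origin.

To stay clear of surface integrals, the divergence theorem is used for compactly supported
fields on the whole space, where it amounts to translation invariance
(\<open>integral_directional_derivative_eq_0\<close>).  The field is cut off with the square of the
tent \<open>max 0 (R - |x|\<^sup>2)\<close>, which shows that \<open>conj(Y) x Y'\<close> is orthogonal to every tent
(\<open>monogenic_integral_tent_eq_0\<close>).  Differentiating in \<open>R\<close> gives orthogonality to the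
indicators of balls, and uniqueness of measures on the line gives it for all radial functions
(\<open>integral_radial_mult_eq_0\<close>), in particular for \<open>(1 - |x|\<^sup>2) powr \<alpha> * w(|x|\<^sup>2)\<close>.

The integral converges absolutely because \<open>(1 - |x|\<^sup>2) powr \<alpha>\<close> is integrable on the unit ball
(\<open>set_integrable_ball_weight\<close>) and the other factor is bounded.
\<close>

section \<open>Continuously differentiable functions\<close>

text \<open>
Continuity of the derivative is demanded direction by direction.  In finite dimension this
is the same as continuity in the operator norm, and it is all that the integration of
partial derivatives asks for.
\<close>

definition continuously_differentiable :: "('a::real_normed_vector \<Rightarrow> 'b::real_normed_vector) \<Rightarrow> bool" where
  "continuously_differentiable f \<longleftrightarrow>
     (\<exists>f'. (\<forall>x. (f has_derivative f' x) (at x)) \<and> (\<forall>h. continuous_on UNIV (\<lambda>x. f' x h)))"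

lemma continuously_differentiableE:
  assumes "continuously_differentiable f"
  obtains f' where "\<And>x. (f has_derivative f' x) (at x)" and "\<And>h. continuous_on UNIV (\<lambda>x. f' x h)"
  using assms unfolding continuously_differentiable_def by blast

lemma continuously_differentiable_imp_continuous_on:
  "continuously_differentiable f \<Longrightarrow> continuous_on UNIV f"
  by (meson continuously_differentiableE continuous_at_imp_continuous_on has_derivative_continuous)

lemma continuously_differentiable_bounded_linear:
  assumes "bounded_linear L"
  shows "continuously_differentiable L"
  unfolding continuously_differentiable_def
  by (intro exI[of _ "\<lambda>_. L"]) (use assms bounded_linear_imp_has_derivative in auto)

lemma continuously_differentiable_const: "continuously_differentiable (\<lambda>x. c)"
  unfolding continuously_differentiable_def
  by (intro exI[of _ "\<lambda>_ _. 0"]) auto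

lemma continuously_differentiable_add:
  assumes "continuously_differentiable f" "continuously_differentiable g"
  shows "continuously_differentiable (\<lambda>x. f x + g x)"
proof -
  obtain f' g' where "\<And>x. (f has_derivative f' x) (at x)" "\<And>h. continuous_on UNIV (\<lambda>x. f' x h)"
    "\<And>x. (g has_derivative g' x) (at x)" "\<And>h. continuous_on UNIV (\<lambda>x. g' x h)"
    using assms by (metis continuously_differentiableE)
  then show ?thesis
    unfolding continuously_differentiable_def
    by (intro exI[of _ "\<lambda>x h. f' x h + g' x h"])
      (auto intro!: has_derivative_add continuous_on_add)
qed

lemma bounded_bilinear_continuously_differentiable:
  assumes "bounded_bilinear p" and "continuously_differentiable f" "continuously_differentiable g"
  shows "continuously_differentiable (\<lambda>x. p (f x) (g x))"
proof -
  obtain f' g' where *: "\<And>x. (f has_derivative f' x) (at x)" "\<And>h. continuous_on UNIV (\<lambda>x. f' x h)"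
    "\<And>x. (g has_derivative g' x) (at x)" "\<And>h. continuous_on UNIV (\<lambda>x. g' x h)"
    using assms(2,3) by (metis continuously_differentiableE)
  moreover note assms(2,3)[THEN continuously_differentiable_imp_continuous_on]
  ultimately show ?thesis
    unfolding continuously_differentiable_def
    by (intro exI[of _ "\<lambda>x h. p (f x) (g' x h) + p (f' x h) (g x)"])
      (auto intro!: bounded_bilinear.FDERIV[OF assms(1)] continuous_on_add bounded_bilinear.continuous_on[OF assms(1)])
qed

lemma continuously_differentiable_sum:
  assumes "\<And>i. i \<in> I \<Longrightarrow> continuously_differentiable (f i)"
  shows "continuously_differentiable (\<lambda>x. \<Sum>i\<in>I. f i x)"
  using assms
  by (induction I rule: infinite_finite_induct)
    (auto intro!: continuously_differentiable_const continuously_differentiable_add)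

lemma real_polynomial_function_imp_continuously_differentiable:
  "real_polynomial_function p \<Longrightarrow> continuously_differentiable p"
  by (induction rule: real_polynomial_function.induct)
    (auto intro: continuously_differentiable_bounded_linear continuously_differentiable_const
      continuously_differentiable_add bounded_bilinear_continuously_differentiable[OF bounded_bilinear_mult])

lemma homogeneous_polynomial_imp_continuously_differentiable:
  fixes f :: "'n::finite point \<Rightarrow> 'a::real_normed_vector"
  assumes "homogeneous_polynomial k f"
  shows "continuously_differentiable f"
proof -
  obtain a where a: "\<And>x. f x = (\<Sum>\<beta>\<in>{\<beta>. (\<Sum>j\<in>UNIV. \<beta> j) = k}. (\<Prod>j\<in>UNIV. x $ j ^ \<beta> j) *\<^sub>R a \<beta>)"
    using assms unfolding homogeneous_polynomial_def by blast
  have "continuously_differentiable (\<lambda>x::'n point. (\<Prod>j\<in>UNIV. x $ j ^ \<beta> j) *\<^sub>R a \<beta>)" for \<beta> :: "'n \<Rightarrow> nat"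
    by (intro bounded_bilinear_continuously_differentiable[OF bounded_bilinear_scaleR]
        continuously_differentiable_const real_polynomial_function_imp_continuously_differentiable
        real_polynomial_function_prod real_polynomial_function_power
        real_polynomial_function.intros(1) bounded_linear_vec_nth) auto
  then show ?thesis
    unfolding a[abs_def] by (rule continuously_differentiable_sum)
qed

section \<open>The divergence theorem for compact support\<close>

lemma integral_translation_lborel:
  fixes u :: "'a::euclidean_space \<Rightarrow> 'b::{banach, second_countable_topology}"
  assumes "u \<in> borel_measurable borel"
  shows "(\<integral>x. u (x + a) \<partial>lborel) = (\<integral>x. u x \<partial>lborel)"
proof -
  have "(\<integral>x. u x \<partial>lborel) = (\<integral>x. u x \<partial>distr lborel borel ((+) a))"
    by (simp add: lborel_distr_plus)
  also have "\<dots> = (\<integral>x. u (x + a) \<partial>lborel)"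
    using assms by (subst integral_distr) (auto simp: add.commute)
  finally show ?thesis by simp
qed

text \<open>
The difference quotients of \<open>u\<close> in the direction \<open>h\<close> have integral \<open>0\<close>, because
Lebesgue measure is translation invariant.  They converge to the directional derivative,
and the mean value theorem bounds them by a constant on a fixed ball outside of which they
vanish, so dominated convergence carries the integral \<open>0\<close> over to the limit.
\<close>

lemma integral_directional_derivative_eq_0:
  fixes u :: "'a::euclidean_space \<Rightarrow> 'b::{banach, second_countable_topology}"
  assumes deriv: "\<And>x. (u has_derivative u' x) (at x)"
    and cont: "continuous_on UNIV (\<lambda>x. u' x h)"
    and supp: "\<And>x. r < norm x \<Longrightarrow> u x = 0"
  shows "(\<integral>x. u' x h \<partial>lborel) = 0" and "integrable lborel (\<lambda>x. u' x h)"
proof -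
  define t where "t = (\<lambda>n. 1 / real (Suc n))"
  define s where "s = (\<lambda>n x. (u (x + t n *\<^sub>R h) - u x) /\<^sub>R t n)"
  have t: "0 < t n" "t n \<le> 1" for n by (auto simp: t_def divide_simps)
  have t0: "t \<longlonglongrightarrow> 0" unfolding t_def by (rule LIMSEQ_inverse_real_of_nat[unfolded inverse_eq_divide])
  have lin: "linear (u' x)" for x
    using deriv has_derivative_linear by blast
  have cu: "continuous_on UNIV u"
    using deriv by (meson continuous_at_imp_continuous_on has_derivative_continuous)
  then have mu[measurable]: "u \<in> borel_measurable borel"
    by (rule borel_measurable_continuous_onI)
  have [measurable]: "(\<lambda>x. u' x h) \<in> borel_measurable borel"
    using cont by (rule borel_measurable_continuous_onI)
  have line: "((\<lambda>a. u (x + a *\<^sub>R h)) has_derivative (\<lambda>a. a *\<^sub>R u' (x + b *\<^sub>R h) h)) (at b)" for x b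
  proof -
    have "((\<lambda>a. u (x + a *\<^sub>R h)) has_derivative (\<lambda>a. u' (x + b *\<^sub>R h) (a *\<^sub>R h))) (at b)"
      by (rule has_derivative_compose[of "\<lambda>a. x + a *\<^sub>R h" "\<lambda>a. a *\<^sub>R h", OF _ deriv])
        (auto intro!: derivative_eq_intros)
    then show ?thesis by (simp add: linear_scale[OF lin])
  qed
  have lim: "(\<lambda>n. s n x) \<longlonglongrightarrow> u' x h" for x
  proof -
    have "((\<lambda>y. norm (u (x + y *\<^sub>R h) - u x - y *\<^sub>R u' x h) / norm y) \<longlongrightarrow> 0) (at 0)"
      using line[of x 0] by (simp add: has_derivative_at)
    moreover have "filterlim t (at 0) sequentially"
      using t0 t(1) by (simp add: filterlim_at less_imp_neq[symmetric])
    ultimately have "(\<lambda>n. norm (u (x + t n *\<^sub>R h) - u x - t n *\<^sub>R u' x h) / norm (t n)) \<longlonglongrightarrow> 0"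
      by (rule filterlim_compose)
    moreover have "norm (u (x + t n *\<^sub>R h) - u x - t n *\<^sub>R u' x h) / norm (t n) =
        norm (s n x - u' x h)" for n
    proof -
      have "s n x - u' x h = (u (x + t n *\<^sub>R h) - u x - t n *\<^sub>R u' x h) /\<^sub>R t n"
        using t(1)[of n] by (simp add: s_def scaleR_right_diff_distrib)
      then show ?thesis using t(1)[of n] by (simp add: divide_inverse mult.commute)
    qed
    ultimately have "(\<lambda>n. norm (s n x - u' x h)) \<longlonglongrightarrow> 0" by simp
    then have "(\<lambda>n. s n x - u' x h) \<longlonglongrightarrow> 0" by (rule tendsto_norm_zero_cancel)
    then show ?thesis by (rule LIM_zero_cancel)
  qed
  \<comment> \<open>For a step of length at most \<open>norm h\<close> from a point where a difference quotient need not vanish,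
    the segment stays in this ball.\<close>
  obtain B where B: "\<And>x. x \<in> cball 0 (r + 2 * norm h) \<Longrightarrow> norm (u' x h) \<le> B"
  proof -
    have "compact ((\<lambda>x. u' x h) ` cball 0 (r + 2 * norm h))"
      by (intro compact_continuous_image continuous_on_subset[OF cont]) auto
    then show ?thesis using that compact_imp_bounded bounded_iff by (metis imageI)
  qed
  have bound: "norm (s n x) \<le> indicator (cball 0 (r + norm h)) x *\<^sub>R B" for n x
  proof (cases "x \<in> cball 0 (r + norm h)")
    case True
    have "norm (u (x + t n *\<^sub>R h) - u (x + 0 *\<^sub>R h)) \<le> B * norm (t n - 0)"
    proof (rule differentiable_bound[of "{0..t n}"])
      fix b assume b: "b \<in> {0..t n}"
      show "((\<lambda>a. u (x + a *\<^sub>R h)) has_derivative (\<lambda>a. a *\<^sub>R u' (x + b *\<^sub>R h) h)) (at b within {0..t n})"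
        using line has_derivative_at_withinI by blast
      have "norm (x + b *\<^sub>R h) \<le> norm x + b * norm h"
        using norm_triangle_ineq[of x "b *\<^sub>R h"] b by simp
      also have "\<dots> \<le> norm x + 1 * norm h"
        using b t(2)[of n] by (intro add_left_mono mult_right_mono) auto
      also have "\<dots> \<le> r + 2 * norm h" using True by simp
      finally have "norm (u' (x + b *\<^sub>R h) h) \<le> B" by (intro B) simp
      then show "onorm (\<lambda>a. a *\<^sub>R u' (x + b *\<^sub>R h) h) \<le> B"
        by (intro onorm_le) (simp add: mult.commute[of B] mult_left_mono)
    qed (use t(1)[of n] in auto)
    moreover have "norm (s n x) = norm (u (x + t n *\<^sub>R h) - u x) / t n"
      using t(1)[of n] by (simp add: s_def divide_inverse mult.commute)
    ultimately show ?thesis using True t(1)[of n] by (simp add: pos_divide_le_eq)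
  next
    case False
    then have 1: "r + norm h < norm x" by simp
    have "norm (t n *\<^sub>R h) \<le> norm h"
      using t[of n] by (simp add: mult_left_le_one_le)
    then have "r < norm (x + t n *\<^sub>R h)"
      using 1 norm_triangle_ineq4[of "x + t n *\<^sub>R h" "t n *\<^sub>R h"] by simp
    moreover have "r < norm x" using 1 norm_ge_zero[of h] by linarith
    ultimately show ?thesis using 1 by (simp add: s_def supp indicator_def)
  qed
  have int_B: "integrable lborel (\<lambda>x. indicator (cball 0 (r + norm h)) x *\<^sub>R B)"
    by (rule borel_integrable_compact) auto
  have int_u: "integrable lborel u"
  proof -
    have "integrable lborel (\<lambda>x. indicator (cball 0 r) x *\<^sub>R u x)"
      by (rule borel_integrable_compact) (auto intro: continuous_on_subset[OF cu])
    moreover have "(\<lambda>x. indicator (cball 0 r) x *\<^sub>R u x) = u"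
      using supp by (auto simp: indicator_def fun_eq_iff)
    ultimately show ?thesis by simp
  qed
  have int_tr: "integrable lborel (\<lambda>x. u (x + a))" for a
  proof -
    have "integrable (distr lborel borel ((+) a)) u" using int_u by (simp add: lborel_distr_plus)
    then show ?thesis by (subst (asm) integrable_distr_eq) (auto simp: add.commute)
  qed
  have [measurable]: "s n \<in> borel_measurable borel" for n
    unfolding s_def by measurable
  have "(\<integral>x. s n x \<partial>lborel) = 0" for n
    unfolding s_def using int_u int_tr integral_translation_lborel[OF mu] by simp
  moreover have "(\<lambda>n. \<integral>x. s n x \<partial>lborel) \<longlonglongrightarrow> (\<integral>x. u' x h \<partial>lborel)"
    by (rule integral_dominated_convergence[OF _ _ int_B]) (use lim bound in auto)
  ultimately show "(\<integral>x. u' x h \<partial>lborel) = 0"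
    by (simp add: LIMSEQ_const_iff)
  show "integrable lborel (\<lambda>x. u' x h)"
    by (rule integrable_dominated_convergence[where s = s, OF _ _ int_B]) (use lim bound in auto)
qed

section \<open>Cauchy's theorem for a pair of monogenic functions\<close>

lemma partial_deriv_eq:
  assumes "(f has_derivative f') (at x)"
  shows "partial_deriv j f x = f' (axis j 1)"
proof -
  have "((\<lambda>t. f (x + t *\<^sub>R axis j 1)) has_derivative (\<lambda>t. f' (t *\<^sub>R axis j 1))) (at 0)"
    by (rule has_derivative_compose[of "\<lambda>t. x + t *\<^sub>R axis j 1" "\<lambda>t. t *\<^sub>R axis j 1"])
      (use assms in \<open>auto intro!: derivative_eq_intros\<close>)
  then show ?thesis
    unfolding partial_deriv_def using linear_scale[OF has_derivative_linear[OF assms]]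
    by (intro vector_derivative_at) (simp add: has_vector_derivative_def)
qed

lemma has_real_derivative_max_0_square:
  "((\<lambda>s::real. (max 0 s)\<^sup>2) has_real_derivative 2 * max 0 s) (at s)"
proof (cases s "0::real" rule: linorder_cases)
  case less
  have "((\<lambda>s::real. 0) has_real_derivative 0) (at s)" by simp
  from has_field_derivative_transform_within_open[OF this, of "{..<0}" "\<lambda>s. (max 0 s)\<^sup>2"]
  show ?thesis using less by simp
next
  case greater
  have "((\<lambda>s::real. s\<^sup>2) has_real_derivative 2 * s) (at s)"
    by (auto intro!: derivative_eq_intros)
  from has_field_derivative_transform_within_open[OF this, of "{0<..}" "\<lambda>s. (max 0 s)\<^sup>2"]
  show ?thesis using greater by simp
next
  case equal
  have "((\<lambda>h::real. (max 0 h)\<^sup>2 / h) \<longlongrightarrow> 0) (at 0)"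
  proof (rule Lim_null_comparison)
    show "\<forall>\<^sub>F h in at 0. norm ((max 0 h)\<^sup>2 / h) \<le> \<bar>h\<bar>"
      by (rule always_eventually) (auto simp: max_def power2_eq_square)
    show "((\<lambda>h::real. \<bar>h\<bar>) \<longlongrightarrow> 0) (at 0)"
      by (auto intro!: tendsto_eq_intros)
  qed
  then show ?thesis using equal by (simp add: DERIV_def)
qed

lemma bounded_bilinear_clifford_mult:
  "bounded_bilinear (clifford_mult :: 'n::{finite,linorder} clifford \<Rightarrow> _)"
  using bilinear_clifford_mult bilinear_conv_bounded_bilinear by blast

lemma bounded_linear_clifford_conj:
  "bounded_linear (clifford_conj :: 'n::{finite,linorder} clifford \<Rightarrow> _)"
  using linear_clifford_conj linear_conv_bounded_linear by blast

lemma linear_clifford_vec: "linear (clifford_vec :: 'n::{finite,linorder} point \<Rightarrow> _)"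
  by (rule linearI) (simp_all add: clifford_vec_def algebra_simps sum.distrib scaleR_sum_right)

lemma continuous_on_conj_vec_mult:
  fixes f g :: "'n::{finite,linorder} point \<Rightarrow> 'n clifford"
  assumes "continuously_differentiable f" "continuously_differentiable g"
  shows "continuous_on UNIV (\<lambda>x. clifford_conj (f x) \<odot> (clifford_vec x \<odot> g x))"
proof -
  have "continuous_on UNIV (clifford_vec :: 'n point \<Rightarrow> _)"
    using linear_clifford_vec linear_continuous_on linear_conv_bounded_linear by blast
  moreover note assms[THEN continuously_differentiable_imp_continuous_on]
  ultimately show ?thesis
    by (intro bounded_bilinear.continuous_on[OF bounded_bilinear_clifford_mult]
        bounded_linear.continuous_on[OF bounded_linear_clifford_conj])
qed

text \<open>
This is Cauchy's theorem of Clifford analysis, integrated over the radii.  With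
\<open>\<rho> x = max 0 (R - |x|\<^sup>2)\<close>, the field whose \<open>j\<close>-th component is
\<open>\<rho>\<^sup>2 conj(f) e\<^sub>j g\<close> is continuously differentiable with compact support, so its
divergence has integral \<open>0\<close>.  When the derivatives fall on \<open>f\<close> and \<open>g\<close>, they add up to
\<open>conj(f) (\<partial> g) - conj(\<partial> f) g = 0\<close>; the sign is that of \<open>conj(e\<^sub>j) = - e\<^sub>j\<close>.  What is left
comes from the cutoff and is \<open>- 4 \<rho> conj(f) x g\<close>.  The square in \<open>\<rho>\<^sup>2\<close> makes the field
differentiable across the sphere \<open>|x|\<^sup>2 = R\<close>.
\<close>

lemma monogenic_integral_tent_eq_0:
  fixes f g :: "'n::{finite,linorder} point \<Rightarrow> 'n clifford"
  assumes f: "continuously_differentiable f" "\<And>x. dirac f x = 0"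
    and g: "continuously_differentiable g" "\<And>x. dirac g x = 0"
  shows "integrable lborel (\<lambda>x. max 0 (R - (norm x)\<^sup>2) *\<^sub>R (clifford_conj (f x) \<odot> (clifford_vec x \<odot> g x)))"
    and "(\<integral>x. max 0 (R - (norm x)\<^sup>2) *\<^sub>R (clifford_conj (f x) \<odot> (clifford_vec x \<odot> g x)) \<partial>lborel) = 0"
proof -
  interpret mult: bounded_bilinear "clifford_mult :: 'n clifford \<Rightarrow> _"
    by (rule bounded_bilinear_clifford_mult)
  interpret conj: bounded_linear "clifford_conj :: 'n clifford \<Rightarrow> _"
    by (rule bounded_linear_clifford_conj)
  obtain f' where f': "\<And>x. (f has_derivative f' x) (at x)" "\<And>h. continuous_on UNIV (\<lambda>x. f' x h)"
    using f(1) continuously_differentiableE by blast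
  obtain g' where g': "\<And>x. (g has_derivative g' x) (at x)" "\<And>h. continuous_on UNIV (\<lambda>x. g' x h)"
    using g(1) continuously_differentiableE by blast
  have cf: "continuous_on UNIV f" and cg: "continuous_on UNIV g"
    using f(1) g(1) continuously_differentiable_imp_continuous_on by auto
  define \<rho> where "\<rho> = (\<lambda>x::'n point. max 0 (R - (norm x)\<^sup>2))"
  define v where "v = (\<lambda>j x. clifford_conj (f x) \<odot> (gen j \<odot> g x))"
  define v' where "v' = (\<lambda>j x h. clifford_conj (f x) \<odot> (gen j \<odot> g' x h) + clifford_conj (f' x h) \<odot> (gen j \<odot> g x))"
  define u where "u = (\<lambda>j x. (\<rho> x)\<^sup>2 *\<^sub>R v j x)"
  define u' where "u' = (\<lambda>j x h. (\<rho> x)\<^sup>2 *\<^sub>R v' j x h + (- (4 * \<rho> x * (x \<bullet> h))) *\<^sub>R v j x)"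
  have v': "(v j has_derivative v' j x) (at x)" for j x
    unfolding v_def v'_def
    by (rule mult.FDERIV[OF conj.has_derivative[OF f'(1)]
          bounded_linear.has_derivative[OF mult.bounded_linear_right g'(1)]])
  have \<rho>2: "((\<lambda>x. (\<rho> x)\<^sup>2) has_derivative (\<lambda>h. - (4 * \<rho> x * (x \<bullet> h)))) (at x)" for x
  proof -
    have "((\<lambda>x::'n point. R - (norm x)\<^sup>2) has_derivative (\<lambda>h. - (2 * (x \<bullet> h)))) (at x)"
      unfolding power2_norm_eq_inner
      by (auto intro!: derivative_eq_intros simp: inner_commute)
    from has_derivative_compose[OF this has_real_derivative_max_0_square[unfolded has_field_derivative_def]]
    show ?thesis by (simp add: \<rho>_def mult_ac)
  qed
  have u': "(u j has_derivative u' j x) (at x)" for j x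
    unfolding u_def u'_def by (rule has_derivative_scaleR[OF \<rho>2 v'])
  have c\<rho>: "continuous_on UNIV \<rho>" unfolding \<rho>_def by (intro continuous_intros)
  have cconj: "continuous_on UNIV (\<lambda>x. clifford_conj (h x))" if "continuous_on UNIV h" for h :: "'n point \<Rightarrow> 'n clifford"
    using conj.continuous_on[OF that] .
  have cu': "continuous_on UNIV (\<lambda>x. u' j x h)" for j h
    unfolding u'_def v'_def v_def
    by (intro continuous_intros mult.continuous_on c\<rho> cconj cf cg f'(2) g'(2))
  \<comment> \<open>The cutoff vanishes outside the ball of radius \<open>sqrt R\<close>; the absolute value covers negative \<open>R\<close>.\<close>
  have supp: "u j x = 0" if "sqrt \<bar>R\<bar> < norm x" for j x
  proof -
    have "(sqrt \<bar>R\<bar>)\<^sup>2 \<le> (norm x)\<^sup>2" using that by (intro power_mono) auto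
    then have "R \<le> (norm x)\<^sup>2" by simp
    then show ?thesis by (simp add: u_def \<rho>_def)
  qed
  have div_v: "(\<Sum>j\<in>UNIV. v' j x (axis j 1)) = 0" for x
  proof -
    have 1: "(\<Sum>j\<in>UNIV. clifford_conj (f x) \<odot> (gen j \<odot> g' x (axis j 1))) = clifford_conj (f x) \<odot> dirac g x"
      by (simp add: dirac_def partial_deriv_eq[OF g'(1)] clifford_mult_sum_right)
    have "(\<Sum>j\<in>UNIV. clifford_conj (f' x (axis j 1)) \<odot> (gen j \<odot> g x)) =
        - (clifford_conj (dirac f x) \<odot> g x)"
      by (simp add: dirac_def partial_deriv_eq[OF f'(1)] conj.sum clifford_conj_mult clifford_conj_gen
          clifford_mult_sum_left clifford_mult_assoc mult.minus_left mult.minus_right sum_negf)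
    with 1 show ?thesis
      unfolding v'_def by (simp add: sum.distrib f(2) g(2) conj.zero mult.zero_left mult.zero_right)
  qed
  have sum_u: "(\<Sum>j\<in>UNIV. u' j x (axis j 1)) =
      (-4) *\<^sub>R (\<rho> x *\<^sub>R (clifford_conj (f x) \<odot> (clifford_vec x \<odot> g x)))" for x
  proof -
    have "clifford_conj (f x) \<odot> (clifford_vec x \<odot> g x) = (\<Sum>j\<in>UNIV. x $ j *\<^sub>R v j x)"
      by (simp add: clifford_vec_def v_def clifford_mult_linear)
    then show ?thesis
      using div_v[of x]
      by (simp add: u'_def sum.distrib inner_axis scaleR_sum_right[symmetric] sum_negf sum_subtractf)
         (simp add: scaleR_sum_right sum_negf mult.assoc)
  qed
  note integral_u = integral_directional_derivative_eq_0[OF u' cu' supp]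
  have "integrable lborel (\<lambda>x. (-1/4) *\<^sub>R (\<Sum>j\<in>UNIV. u' j x (axis j 1)))"
    using integral_u(2) by (intro integrable_scaleR_right Bochner_Integration.integrable_sum) auto
  then show "integrable lborel (\<lambda>x. max 0 (R - (norm x)\<^sup>2) *\<^sub>R (clifford_conj (f x) \<odot> (clifford_vec x \<odot> g x)))"
    unfolding sum_u by (simp add: \<rho>_def)
  have "(\<integral>x. (-4) *\<^sub>R (\<rho> x *\<^sub>R (clifford_conj (f x) \<odot> (clifford_vec x \<odot> g x))) \<partial>lborel) =
      (\<integral>x. (\<Sum>j\<in>UNIV. u' j x (axis j 1)) \<partial>lborel)" by (simp only: sum_u)
  also have "\<dots> = (\<Sum>j\<in>UNIV. \<integral>x. u' j x (axis j 1) \<partial>lborel)"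
    using integral_u(2) by (intro Bochner_Integration.integral_sum) auto
  also have "\<dots> = 0"
    using integral_u(1) by simp
  finally show "(\<integral>x. max 0 (R - (norm x)\<^sup>2) *\<^sub>R (clifford_conj (f x) \<odot> (clifford_vec x \<odot> g x)) \<partial>lborel) = 0"
    unfolding integral_scaleR_right by (simp add: \<rho>_def)
qed

section \<open>From tents to arbitrary radial weights\<close>

text \<open>
The derivative of \<open>max 0 (R - s)\<close> with respect to \<open>R\<close>, taken from the right at
\<open>R = r\<^sup>2\<close>, is the indicator of \<open>s \<le> r\<^sup>2\<close>.  Its difference quotients lie between \<open>0\<close> and \<open>1\<close>,
so dominated convergence passes from the tents to the balls.
\<close>

lemma integral_cball_eq_0_of_tents:
  fixes \<phi> :: "'a::euclidean_space \<Rightarrow> real"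
  assumes cont: "continuous_on UNIV \<phi>"
    and tents: "\<And>R. (\<integral>x. max 0 (R - (norm x)\<^sup>2) * \<phi> x \<partial>lborel) = 0"
  shows "(\<integral>x. indicator (cball 0 r) x * \<phi> x \<partial>lborel) = 0"
proof (cases "0 \<le> r")
  case True
  define t where "t = (\<lambda>R x. max 0 (R - (norm x)\<^sup>2) * \<phi> x)"
  define s where "s = (\<lambda>n x. real (Suc n) * (t (r\<^sup>2 + 1 / real (Suc n)) x - t (r\<^sup>2) x))"
  have [measurable]: "\<phi> \<in> borel_measurable borel"
    using cont by (rule borel_measurable_continuous_onI)
  have int_t: "integrable lborel (t R)" for R
  proof -
    define \<rho> where "\<rho> = sqrt \<bar>R\<bar>"
    have "integrable lborel (\<lambda>x. indicator (cball 0 \<rho>) x *\<^sub>R t R x)"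
      unfolding t_def
      by (rule borel_integrable_compact) (auto intro!: continuous_intros continuous_on_subset[OF cont])
    moreover have "(\<lambda>x. indicator (cball 0 \<rho>) x *\<^sub>R t R x) = t R"
    proof
      fix x :: 'a
      have "R \<le> (norm x)\<^sup>2" if "\<rho> < norm x"
      proof -
        have "\<rho>\<^sup>2 \<le> (norm x)\<^sup>2" using that by (intro power_mono) (auto simp: \<rho>_def)
        then show ?thesis by (simp add: \<rho>_def)
      qed
      then show "indicator (cball 0 \<rho>) x *\<^sub>R t R x = t R x"
        by (auto simp: indicator_def t_def max_def)
    qed
    ultimately show ?thesis by simp
  qed
  have int_w: "integrable lborel (\<lambda>x. indicator (cball 0 (r + 1)) x *\<^sub>R \<bar>\<phi> x\<bar>)"
    by (rule borel_integrable_compact) (auto intro!: continuous_intros continuous_on_subset[OF cont])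
  have [measurable]: "s n \<in> borel_measurable borel" for n
    unfolding s_def t_def by measurable
  have bound: "norm (s n x) \<le> indicator (cball 0 (r + 1)) x *\<^sub>R \<bar>\<phi> x\<bar>" for n x
  proof (cases "x \<in> cball 0 (r + 1)")
    case True
    have "\<bar>max 0 (r\<^sup>2 + 1 / real (Suc n) - (norm x)\<^sup>2) - max 0 (r\<^sup>2 - (norm x)\<^sup>2)\<bar> \<le> 1 / real (Suc n)"
    proof -
      have "\<bar>max 0 (a + d - b) - max 0 (a - b)\<bar> \<le> d" if "0 \<le> d" for a b d :: real
        using that by (simp add: max_def)
      from this[of "1 / real (Suc n)" "r\<^sup>2" "(norm x)\<^sup>2"] show ?thesis by simp
    qed
    then have "real (Suc n) * \<bar>max 0 (r\<^sup>2 + 1 / real (Suc n) - (norm x)\<^sup>2) - max 0 (r\<^sup>2 - (norm x)\<^sup>2)\<bar> \<le> 1"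
      by (simp add: field_simps)
    then have "(real (Suc n) * \<bar>max 0 (r\<^sup>2 + 1 / real (Suc n) - (norm x)\<^sup>2) - max 0 (r\<^sup>2 - (norm x)\<^sup>2)\<bar>) * \<bar>\<phi> x\<bar> \<le> 1 * \<bar>\<phi> x\<bar>"
      by (intro mult_right_mono) auto
    moreover have "norm (s n x) = (real (Suc n) * \<bar>max 0 (r\<^sup>2 + 1 / real (Suc n) - (norm x)\<^sup>2) - max 0 (r\<^sup>2 - (norm x)\<^sup>2)\<bar>) * \<bar>\<phi> x\<bar>"
      by (simp only: s_def t_def left_diff_distrib[symmetric] real_norm_def abs_mult abs_of_nat mult.assoc)
    ultimately show ?thesis using True by simp
  next
    case False
    then have "(r + 1)\<^sup>2 \<le> (norm x)\<^sup>2" using \<open>0 \<le> r\<close> by (intro power_mono) auto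
    moreover have "r\<^sup>2 + 1 \<le> (r + 1)\<^sup>2" using \<open>0 \<le> r\<close> by (simp add: power2_eq_square algebra_simps)
    moreover have "1 / real (Suc n) \<le> 1" by simp
    ultimately have "r\<^sup>2 + 1 / real (Suc n) \<le> (norm x)\<^sup>2" "r\<^sup>2 \<le> (norm x)\<^sup>2" by linarith+
    then show ?thesis by (simp add: s_def t_def max_def)
  qed
  have lim: "(\<lambda>n. s n x) \<longlonglongrightarrow> indicator (cball 0 r) x * \<phi> x" for x
  proof (cases "norm x \<le> r")
    case True
    then have "(norm x)\<^sup>2 \<le> r\<^sup>2" by (intro power_mono) auto
    then have "max 0 (r\<^sup>2 - (norm x)\<^sup>2) = r\<^sup>2 - (norm x)\<^sup>2"
      and "max 0 (r\<^sup>2 + 1 / real (Suc n) - (norm x)\<^sup>2) = r\<^sup>2 + 1 / real (Suc n) - (norm x)\<^sup>2" for n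
      by (simp_all add: max_def add_increasing2)
    then have "s n x = (real (Suc n) * (1 / real (Suc n))) * \<phi> x" for n
      unfolding s_def t_def by (simp only:) (simp only: left_diff_distrib[symmetric] mult.assoc add_diff_eq diff_add_eq diff_diff_eq2 add_diff_cancel_left' diff_add_cancel, simp add: algebra_simps)
    then have "s n x = \<phi> x" for n by simp
    then show ?thesis using True by simp
  next
    case False
    then have "r\<^sup>2 < (norm x)\<^sup>2" using \<open>0 \<le> r\<close> by (intro power_strict_mono) auto
    moreover have "(\<lambda>n. r\<^sup>2 + 1 / real (Suc n)) \<longlonglongrightarrow> r\<^sup>2 + 0"
      by (intro tendsto_intros LIMSEQ_inverse_real_of_nat[unfolded inverse_eq_divide])
    ultimately have "\<forall>\<^sub>F n in sequentially. r\<^sup>2 + 1 / real (Suc n) < (norm x)\<^sup>2"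
      by (intro order_tendstoD) auto
    then have "\<forall>\<^sub>F n in sequentially. s n x = 0"
      by eventually_elim (use \<open>r\<^sup>2 < (norm x)\<^sup>2\<close> in \<open>simp add: s_def t_def max_def\<close>)
    then have "(\<lambda>n. s n x) \<longlonglongrightarrow> 0" by (rule tendsto_eventually)
    then show ?thesis using False by simp
  qed
  have "(\<integral>x. s n x \<partial>lborel) = 0" for n
    unfolding s_def using int_t tents by (simp add: t_def)
  moreover have "(\<lambda>n. \<integral>x. s n x \<partial>lborel) \<longlonglongrightarrow> (\<integral>x. indicator (cball 0 r) x * \<phi> x \<partial>lborel)"
    by (rule integral_dominated_convergence[OF _ _ int_w])
      (use bound lim in \<open>auto intro!: borel_measurable_times borel_measurable_indicator\<close>)
  ultimately show ?thesis by (simp add: LIMSEQ_const_iff)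
qed simp

text \<open>
Push the measures with densities \<open>max 0 \<phi>\<close> and \<open>max 0 (- \<phi>)\<close> on the unit ball forward
along the norm.  The hypothesis says that the two images agree on all half-lines, so
they are equal, and they give every function of the norm the same integral.  This replaces
polar coordinates and covers weights that blow up at the boundary.  A product that is not
integrable has integral \<open>0\<close> by convention.
\<close>

lemma integral_radial_mult_eq_0:
  fixes \<phi> :: "'a::euclidean_space \<Rightarrow> real" and g :: "real \<Rightarrow> real"
  assumes cont: "continuous_on UNIV \<phi>"
    and balls: "\<And>r. (\<integral>x. indicator (cball 0 r) x * \<phi> x \<partial>lborel) = 0"
    and [measurable]: "g \<in> borel_measurable borel"
  shows "(\<integral>x. indicator (cball 0 1) x * (g (norm x) * \<phi> x) \<partial>lborel) = 0"
proof (cases "integrable lborel (\<lambda>x. indicator (cball 0 1) x * (g (norm x) * \<phi> x))")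
  case True
  define p where "p = (\<lambda>\<epsilon> x. indicator (cball 0 1) x * max 0 (\<epsilon> * \<phi> x))"
  define M where "M = (\<lambda>\<epsilon>. distr (density lborel (\<lambda>x. ennreal (p \<epsilon> x))) borel norm)"
  have [measurable]: "\<phi> \<in> borel_measurable borel"
    using cont by (rule borel_measurable_continuous_onI)
  have [measurable]: "p \<epsilon> \<in> borel_measurable borel" for \<epsilon>
    unfolding p_def by (intro borel_measurable_times borel_measurable_indicator borel_measurable_max) auto
  have p_nonneg: "0 \<le> p \<epsilon> x" for \<epsilon> x by (simp add: p_def)
  have p_diff: "p 1 x - p (-1) x = indicator (cball 0 1) x * \<phi> x" for x
    by (simp add: p_def max_def indicator_def)
  have int_ball: "integrable lborel (\<lambda>x. indicator (cball 0 \<rho>) x * \<phi> x)" for \<rho>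
    using borel_integrable_compact[OF compact_cball continuous_on_subset[OF cont]] by simp
  have int_p: "integrable lborel (p \<epsilon>)" for \<epsilon>
  proof -
    have "continuous_on (cball 0 1) (\<lambda>x. max 0 (\<epsilon> * \<phi> x))"
      by (intro continuous_intros continuous_on_subset[OF cont]) auto
    then show ?thesis
      unfolding p_def using borel_integrable_compact[OF compact_cball] by fastforce
  qed
  have int_pS: "integrable lborel (\<lambda>x. p \<epsilon> x * indicator {x. r < norm x} x)" for \<epsilon> r
    using integrable_mult_indicator[OF _ int_p[of \<epsilon>], of "{x. r < norm x}"] by (simp add: mult.commute)
  have eM: "emeasure (M \<epsilon>) {r<..} = ennreal (\<integral>x. p \<epsilon> x * indicator {x. r < norm x} x \<partial>lborel)" for \<epsilon> r
  proof -
    have "emeasure (M \<epsilon>) {r<..} = (\<integral>\<^sup>+x. ennreal (p \<epsilon> x) * indicator {x. r < norm x} x \<partial>lborel)"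
      unfolding M_def by (subst emeasure_distr) (auto simp: emeasure_density vimage_def)
    also have "\<dots> = (\<integral>\<^sup>+x. ennreal (p \<epsilon> x * indicator {x. r < norm x} x) \<partial>lborel)"
      by (intro nn_integral_cong) (auto simp: indicator_def)
    also have "\<dots> = ennreal (\<integral>x. p \<epsilon> x * indicator {x. r < norm x} x \<partial>lborel)"
      by (intro nn_integral_eq_integral int_pS) (simp add: p_nonneg)
    finally show ?thesis .
  qed
  \<comment> \<open>Both measures live on \<open>{0..1}\<close>, so a half-line starting beyond \<open>1\<close> has measure \<open>0\<close>; the \<open>min\<close> below
    accounts for it.\<close>
  have "M 1 = M (-1)"
  proof (rule measure_eqI_lessThan)
    fix r :: real
    have "(\<integral>x. p 1 x * indicator {x. r < norm x} x \<partial>lborel) -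
          (\<integral>x. p (-1) x * indicator {x. r < norm x} x \<partial>lborel) =
          (\<integral>x. (p 1 x - p (-1) x) * indicator {x. r < norm x} x \<partial>lborel)"
      using int_pS by (simp add: left_diff_distrib)
    also have "\<dots> = (\<integral>x. indicator (cball 0 1) x * \<phi> x - indicator (cball 0 (min r 1)) x * \<phi> x \<partial>lborel)"
      unfolding p_diff by (intro Bochner_Integration.integral_cong) (auto simp: indicator_def)
    also have "\<dots> = 0"
      using int_ball balls by simp
    finally show "emeasure (M 1) {r<..} = emeasure (M (-1)) {r<..}" by (simp add: eM)
    show "emeasure (M 1) {r<..} < \<infinity>" by (simp add: eM)
  qed (simp_all add: M_def)
  moreover have "(\<integral>r. g r \<partial>M \<epsilon>) = (\<integral>x. p \<epsilon> x * g (norm x) \<partial>lborel)" for \<epsilon>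
    unfolding M_def by (simp add: integral_distr integral_density p_nonneg)
  ultimately have eq: "(\<integral>x. p 1 x * g (norm x) \<partial>lborel) = (\<integral>x. p (-1) x * g (norm x) \<partial>lborel)"
    by metis
  have "integrable lborel (\<lambda>x. p \<epsilon> x * g (norm x))" if "\<bar>\<epsilon>\<bar> = 1" for \<epsilon>
  proof (rule Bochner_Integration.integrable_bound[OF True])
    show "AE x in lborel. norm (p \<epsilon> x * g (norm x)) \<le> norm (indicator (cball 0 1) x * (g (norm x) * \<phi> x))"
    proof (rule AE_I2)
      fix x
      have "\<bar>p \<epsilon> x\<bar> \<le> indicator (cball 0 1) x * \<bar>\<phi> x\<bar>"
        using that by (auto simp: p_def indicator_def max_def abs_if split: if_splits)
      then have "\<bar>p \<epsilon> x\<bar> * \<bar>g (norm x)\<bar> \<le> (indicator (cball 0 1) x * \<bar>\<phi> x\<bar>) * \<bar>g (norm x)\<bar>"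
        by (rule mult_right_mono) simp
      then show "norm (p \<epsilon> x * g (norm x)) \<le> norm (indicator (cball 0 1) x * (g (norm x) * \<phi> x))"
        by (simp add: abs_mult mult_ac)
    qed
  qed measurable
  then have "(\<integral>x. p 1 x * g (norm x) - p (-1) x * g (norm x) \<partial>lborel) = 0"
    using eq by (simp add: Bochner_Integration.integral_diff)
  moreover have "p 1 x * g (norm x) - p (-1) x * g (norm x) =
      indicator (cball 0 1) x * (g (norm x) * \<phi> x)" for x
    using p_diff[of x] by (metis left_diff_distrib mult.assoc mult.commute)
  ultimately show ?thesis by simp
qed (rule not_integrable_integral_eq)

text \<open>
The real case applies to each coordinate of \<open>conj(f) x g\<close>; going to coordinates
commutes with the integral because the function is integrable in this case.
\<close>

lemma monogenic_integral_radial_eq_0: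
  fixes f g :: "'n::{finite,linorder} point \<Rightarrow> 'n clifford" and w :: "real \<Rightarrow> real"
  assumes f: "continuously_differentiable f" "\<And>x. dirac f x = 0"
    and g: "continuously_differentiable g" "\<And>x. dirac g x = 0"
    and w: "w \<in> borel_measurable borel"
  shows "(\<integral>x. indicator (cball 0 1) x *\<^sub>R
    (w (norm x) *\<^sub>R (clifford_conj (f x) \<odot> (clifford_vec x \<odot> g x))) \<partial>lborel) = 0"
proof (cases "integrable lborel (\<lambda>x. indicator (cball 0 1) x *\<^sub>R
    (w (norm x) *\<^sub>R (clifford_conj (f x) \<odot> (clifford_vec x \<odot> g x))))")
  case True
  define W where "W = (\<lambda>x. clifford_conj (f x) \<odot> (clifford_vec x \<odot> g x))"
  have cont: "continuous_on UNIV W"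
    unfolding W_def using f(1) g(1) by (rule continuous_on_conj_vec_mult)
  have tents: "(\<integral>x. max 0 (R - (norm x)\<^sup>2) * (W x $ A) \<partial>lborel) = 0" for R A
    using integral_bounded_linear[OF bounded_linear_vec_nth[of A]
        monogenic_integral_tent_eq_0(1)[OF f g, of R]] monogenic_integral_tent_eq_0(2)[OF f g, of R]
    by (simp add: W_def)
  have "(\<integral>x. indicator (cball 0 1) x *\<^sub>R (w (norm x) *\<^sub>R W x) \<partial>lborel) $ A = 0" for A
  proof -
    have cont_A: "continuous_on UNIV (\<lambda>x. W x $ A)"
      using cont by (intro continuous_intros)
    have "(\<integral>x. indicator (cball 0 1) x *\<^sub>R (w (norm x) *\<^sub>R W x) \<partial>lborel) $ A =
        (\<integral>x. indicator (cball 0 1) x * (w (norm x) * (W x $ A)) \<partial>lborel)"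
      using integral_bounded_linear[OF bounded_linear_vec_nth[of A] True] by (simp add: W_def mult.assoc)
    also have "\<dots> = 0"
      by (intro integral_radial_mult_eq_0 integral_cball_eq_0_of_tents cont_A tents w)
    finally show ?thesis .
  qed
  then show ?thesis by (simp add: vec_eq_iff W_def)
qed (rule not_integrable_integral_eq)

section \<open>Integrability of the weight\<close>

text \<open>
For \<open>m = DIM('a)\<close>, the ball of radius \<open>r\<close> has volume \<open>V r^m\<close>.  Hence, for a point that is
uniformly distributed in the unit ball, \<open>|x|^m\<close> is uniformly distributed in \<open>[0,1]\<close>, and so
is \<open>1 - |x|^m\<close>.
\<close>

lemma distr_ball_one_minus_norm_power:
  defines "V \<equiv> measure lborel (ball (0::'a::euclidean_space) 1)"
  shows "distr (density lborel (\<lambda>x. ennreal (indicator (ball 0 1) x))) borel (\<lambda>x::'a. 1 - norm x ^ DIM('a)) =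
    density lborel (\<lambda>t. ennreal (V * indicator {0..1} t))" (is "?L = ?R")
proof (rule measure_eqI_lessThan)
  fix t :: real
  \<comment> \<open>\<open>q\<close> is the length of \<open>{0..1} \<inter> {t<..}\<close>, and, with \<open>m = DIM('a)\<close>, the points of the unit
    ball with \<open>t < 1 - |x|^m\<close> are exactly those with \<open>|x| < root m q\<close>.\<close>
  define q where "q = max 0 (min 1 (1 - t))"
  have q: "0 \<le> q" by (simp add: q_def)
  have iff: "norm x < root DIM('a) q \<longleftrightarrow> norm x < 1 \<and> t < 1 - norm x ^ DIM('a)" for x :: 'a
  proof -
    have "norm x < root DIM('a) q \<longleftrightarrow> norm x ^ DIM('a) < q"
      using q by (metis DIM_positive norm_ge_zero real_root_less_iff real_root_power_cancel)
    also have "\<dots> \<longleftrightarrow> norm x ^ DIM('a) < 1 \<and> t < 1 - norm x ^ DIM('a)"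
      using zero_le_power[OF norm_ge_zero[of x], of "DIM('a)"] unfolding q_def by linarith
    also have "norm x ^ DIM('a) < 1 \<longleftrightarrow> norm x < 1"
      using power_less_one_iff[of "norm x" "DIM('a)"] by simp
    finally show ?thesis .
  qed
  have "emeasure ?L {t<..} = (\<integral>\<^sup>+x. indicator (ball 0 (root DIM('a) q)) x \<partial>(lborel::'a measure))"
  proof -
    have [measurable]: "(\<lambda>x::'a. ennreal (indicator (ball 0 1) x)) \<in> borel_measurable borel"
      by (simp add: ennreal_indicator borel_measurable_indicator)
    have "emeasure ?L {t<..} = (\<integral>\<^sup>+x. ennreal (indicator (ball 0 1) x) *
        indicator ((\<lambda>x. 1 - norm x ^ DIM('a)) -` {t<..}) x \<partial>(lborel::'a measure))"
      by (subst emeasure_distr, simp, simp, subst emeasure_density)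
        (simp_all add: ennreal_indicator borel_measurable_indicator vimage_def)
    also have "\<dots> = (\<integral>\<^sup>+x. indicator (ball 0 (root DIM('a) q)) x \<partial>(lborel::'a measure))"
      by (intro nn_integral_cong) (auto simp: iff split: split_indicator)
    finally show ?thesis .
  qed
  also have "\<dots> = emeasure lborel (ball (0::'a) (root DIM('a) q))" by simp
  also have "\<dots> = ennreal (measure lborel (ball (0::'a) (root DIM('a) q)))"
    using emeasure_lborel_ball_finite[of "0::'a" "root DIM('a) q"]
    by (intro emeasure_eq_ennreal_measure) (simp add: less_top[symmetric])
  also have "measure lborel (ball (0::'a) (root DIM('a) q)) = root DIM('a) q ^ DIM('a) * V"
    unfolding V_def by (rule content_ball_conv_unit_ball) (simp add: q)
  also have "root DIM('a) q ^ DIM('a) = q" using q by simp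
  finally have L: "emeasure ?L {t<..} = ennreal (q * V)" .
  have "emeasure ?R {t<..} = (\<integral>\<^sup>+s. ennreal V * indicator ({0..1} \<inter> {t<..}) s \<partial>lborel)"
    by (auto simp: emeasure_density intro!: nn_integral_cong split: split_indicator)
  also have "\<dots> = ennreal V * emeasure lborel ({0..1} \<inter> {t<..})"
    by (simp add: nn_integral_cmult)
  also have "emeasure lborel ({0..1} \<inter> {t<..}) = ennreal q"
  proof (cases "t < 0")
    case True
    then have "{0..1} \<inter> {t<..} = {0..1}" by auto
    then show ?thesis using True by (simp add: q_def)
  next
    case False
    then have "{0..1} \<inter> {t<..} = {t<..1}" by auto
    then show ?thesis using False by (cases "t \<le> 1") (auto simp: q_def max_def min_def)
  qed
  finally have R: "emeasure ?R {t<..} = ennreal (q * V)"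
    by (simp add: ennreal_mult' mult.commute V_def q_def)
  show "emeasure ?L {t<..} = emeasure ?R {t<..}" unfolding L R ..
  show "emeasure ?L {t<..} < \<infinity>" by (simp add: L)
qed simp_all

lemma one_minus_power_le: "1 - (r::real) ^ n \<le> real n * (1 - r)" if "0 \<le> r"
  using Bernoulli_inequality[of "r - 1" n] that by (simp add: algebra_simps)

text \<open>
Only negative \<open>\<alpha>\<close> is delicate.  Bernoulli's inequality gives
\<open>1 - |x|^m \<le> m (1 - |x|) \<le> m (1 - |x|\<^sup>2)\<close>, so the weight is at most a constant times
\<open>(1 - |x|^m) powr \<alpha>\<close>.  As \<open>1 - |x|^m\<close> is uniformly distributed, this majorant is
integrable because \<open>t powr \<alpha>\<close> is integrable on \<open>[0,1]\<close> for \<open>\<alpha> > -1\<close>.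
\<close>

lemma set_integrable_ball_weight:
  assumes "-1 < \<alpha>"
  shows "set_integrable lborel (ball (0::'a::euclidean_space) 1) (\<lambda>x. (1 - (norm x)\<^sup>2) powr \<alpha>)"
proof -
  define m where "m = DIM('a)"
  define V where "V = measure lborel (ball (0::'a) 1)"
  have m: "0 < m" by (simp add: m_def)
  define C where "C = max 1 (real m powr (- \<alpha>))"
  have "set_integrable lebesgue {0..1::real} (\<lambda>t. t powr \<alpha>)"
    using integrable_on_powr_from_0[of \<alpha> 1] assms
    by (intro nonnegative_absolutely_integrable_1) auto
  then have I: "integrable lborel (\<lambda>t. V * indicator {0..1::real} t * t powr \<alpha>)"
    unfolding set_integrable_def by (subst (asm) integrable_completion) (auto simp: mult.assoc)
  have "integrable (density lborel (\<lambda>t. ennreal (V * indicator {0..1} t))) (\<lambda>t. t powr \<alpha>)"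
    by (subst integrable_density) (use I in \<open>auto simp: V_def mult.assoc\<close>)
  then have "integrable (distr (density lborel (\<lambda>x. ennreal (indicator (ball 0 1) x))) borel
      (\<lambda>x::'a. 1 - norm x ^ m)) (\<lambda>t. t powr \<alpha>)"
    unfolding m_def V_def distr_ball_one_minus_norm_power .
  then have "integrable lborel (\<lambda>x::'a. indicator (ball 0 1) x * (1 - norm x ^ m) powr \<alpha>)"
    by (subst (asm) integrable_distr_eq, simp, simp, subst (asm) integrable_density)
      (auto intro!: borel_measurable_indicator)
  then have J: "integrable lborel (\<lambda>x::'a. C * (indicator (ball 0 1) x * (1 - norm x ^ m) powr \<alpha>))"
    by simp
  have K: "integrable lborel (\<lambda>x::'a. indicator (ball 0 1) x :: real)"
    using emeasure_lborel_ball_finite[of "0::'a" 1] by simp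
  show ?thesis unfolding set_integrable_def
  proof (rule Bochner_Integration.integrable_bound[OF Bochner_Integration.integrable_add[OF J K]])
    show "(\<lambda>x::'a. indicator (ball 0 1) x *\<^sub>R (1 - (norm x)\<^sup>2) powr \<alpha>) \<in> borel_measurable lborel"
      by (intro borel_measurable_scaleR borel_measurable_indicator) auto
    show "AE x::'a in lborel. norm (indicator (ball 0 1) x *\<^sub>R (1 - (norm x)\<^sup>2) powr \<alpha>) \<le>
        norm (C * (indicator (ball 0 1) x * (1 - norm x ^ m) powr \<alpha>) + indicator (ball 0 1) x)"
    proof (rule AE_I2)
      fix x :: 'a
      show "norm (indicator (ball 0 1) x *\<^sub>R (1 - (norm x)\<^sup>2) powr \<alpha>) \<le>
        norm (C * (indicator (ball 0 1) x * (1 - norm x ^ m) powr \<alpha>) + indicator (ball 0 1) x)"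
      proof (cases "x \<in> ball 0 1")
        case True
        then have x: "norm x < 1" by simp
        have p: "0 < 1 - norm x ^ m" using x m power_less_one_iff[of "norm x" m] by simp
        have q: "0 < 1 - (norm x)\<^sup>2" using x power_less_one_iff[of "norm x" 2] by simp
        have "(1 - (norm x)\<^sup>2) powr \<alpha> \<le> C * (1 - norm x ^ m) powr \<alpha> + 1"
        proof (cases "0 \<le> \<alpha>")
          case True
          then have "(1 - (norm x)\<^sup>2) powr \<alpha> \<le> 1" using q by (intro powr_le1) auto
          moreover have "0 \<le> C * (1 - norm x ^ m) powr \<alpha>" by (simp add: C_def)
          ultimately show ?thesis by linarith
        next
          case False
          have "(norm x)\<^sup>2 \<le> norm x" using x by (simp add: power2_eq_square mult_left_le_one_le)
          then have "1 - norm x ^ m \<le> real m * (1 - (norm x)\<^sup>2)"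
            using one_minus_power_le[of "norm x" m] mult_left_mono[of "1 - norm x" "1 - (norm x)\<^sup>2" "real m"]
            by simp
          then have "(1 - norm x ^ m) / m \<le> 1 - (norm x)\<^sup>2" using m by (simp add: field_simps)
          then have "(1 - (norm x)\<^sup>2) powr \<alpha> \<le> ((1 - norm x ^ m) / m) powr \<alpha>"
            using False p m by (intro powr_mono2') auto
          also have "\<dots> = real m powr (- \<alpha>) * (1 - norm x ^ m) powr \<alpha>"
            using p m by (simp add: powr_divide powr_minus_divide)
          also have "\<dots> \<le> C * (1 - norm x ^ m) powr \<alpha>"
            by (intro mult_right_mono) (auto simp: C_def)
          finally show ?thesis by simp
        qed
        then show ?thesis using True by simp
      qed simp
    qed
  qed
qed

lemma set_integrable_ball_weight_mult:
  fixes h :: "'a::euclidean_space \<Rightarrow> 'b::{banach, second_countable_topology}"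
  assumes "-1 < \<alpha>" and cont: "continuous_on (cball 0 1) h"
  shows "set_integrable lborel (ball 0 1) (\<lambda>x. (1 - (norm x)\<^sup>2) powr \<alpha> *\<^sub>R h x)"
proof -
  obtain K where K: "\<And>x. x \<in> cball 0 1 \<Longrightarrow> norm (h x) \<le> K"
    using compact_imp_bounded[OF compact_continuous_image[OF cont compact_cball]]
    unfolding bounded_iff by blast
  have I: "integrable lborel (\<lambda>x::'a. K * (indicator (ball 0 1) x *\<^sub>R (1 - (norm x)\<^sup>2) powr \<alpha>))"
    using set_integrable_ball_weight[OF assms(1)] unfolding set_integrable_def by (rule integrable_mult_right)
  have m: "(\<lambda>x. indicator (ball 0 1) x *\<^sub>R h x) \<in> borel_measurable borel"
    by (intro borel_measurable_continuous_on_indicator continuous_on_subset[OF cont]) auto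
  have "(\<lambda>x. (1 - (norm x)\<^sup>2) powr \<alpha> *\<^sub>R (indicator (ball 0 1) x *\<^sub>R h x)) \<in> borel_measurable borel"
    by (intro borel_measurable_scaleR m) auto
  then show ?thesis unfolding set_integrable_def
  proof (intro Bochner_Integration.integrable_bound[OF I] AE_I2)
    fix x :: 'a
    show "norm (indicator (ball 0 1) x *\<^sub>R (1 - (norm x)\<^sup>2) powr \<alpha> *\<^sub>R h x) \<le>
        norm (K * (indicator (ball 0 1) x *\<^sub>R (1 - (norm x)\<^sup>2) powr \<alpha>))"
    proof (cases "x \<in> ball 0 1")
      case True
      then have "norm (h x) \<le> \<bar>K\<bar>" using K[of x] by simp
      then have "(1 - (norm x)\<^sup>2) powr \<alpha> * norm (h x) \<le> (1 - (norm x)\<^sup>2) powr \<alpha> * \<bar>K\<bar>"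
        by (rule mult_left_mono) simp
      then show ?thesis using True by (simp add: abs_mult mult.commute)
    qed simp
  qed (simp add: mult.commute)
qed

section \<open>Orthogonality of even and odd eigenfunctions\<close>

lemma smooth_on_unit_interval_imp_continuous_on:
  assumes "smooth_on_unit_interval F"
  shows "continuous_on {0..1} F"
proof -
  obtain D where D: "\<forall>t\<in>{0..1}. D 0 t = F t"
    "\<forall>t\<in>{0..1}. (D (0::nat) has_real_derivative D (Suc 0) t) (at t within {0..1})"
    using assms unfolding smooth_on_unit_interval_def by blast
  have "continuous_on {0..1} (D 0)"
    using D(2) by (auto intro: DERIV_continuous_on)
  moreover have "continuous_on {0..1} F \<longleftrightarrow> continuous_on {0..1} (D 0)"
    using D(1) by (intro continuous_on_cong) auto
  ultimately show ?thesis by simp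
qed

theorem proposition5p6:
  fixes c \<alpha> :: real
    and Y :: "nat \<Rightarrow> nat \<Rightarrow> 'n::{finite,linorder} point \<Rightarrow> 'n clifford"
    and \<mu> \<nu> :: "nat \<Rightarrow> nat \<Rightarrow> real"
    and P Q :: "nat \<Rightarrow> nat \<Rightarrow> real \<Rightarrow> real"
  assumes "2 \<le> CARD('n)" and "0 \<le> c" and "-1 < \<alpha>"
    and "\<And>k. orthonormal_monogenic_basis k (Y k)"
    and "\<And>k i. i \<in> {1..monogenic_dim CARD('n) k} \<Longrightarrow>
           enumerates_eigen_profiles c \<alpha> (Y k i) (\<mu> k) (P k)"
    and "\<And>k i. i \<in> {1..monogenic_dim CARD('n) k} \<Longrightarrow>
           enumerates_eigen_profiles c \<alpha> (vec_multiple (Y k i)) (\<nu> k) (Q k)"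
  shows "\<forall>N N' k k'. \<forall>i\<in>{1..monogenic_dim CARD('n) k}. \<forall>i'\<in>{1..monogenic_dim CARD('n) k'}.
    set_integrable lborel (ball 0 1)
      (\<lambda>x. (1 - (norm x)\<^sup>2) powr \<alpha> *\<^sub>R
        (clifford_conj (even_cpswf (P k) (Y k i) N x) \<odot> odd_cpswf (Q k') (Y k' i') N' x)) \<and>
    (LINT x:ball 0 1|lborel. (1 - (norm x)\<^sup>2) powr \<alpha> *\<^sub>R
        (clifford_conj (even_cpswf (P k) (Y k i) N x) \<odot> odd_cpswf (Q k') (Y k' i') N' x)) = 0"
proof (intro allI ballI)
  fix N N' k k' i i'
  assume i: "i \<in> {1..monogenic_dim CARD('n) k}" and i': "i' \<in> {1..monogenic_dim CARD('n) k'}"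
  define W where "W = (\<lambda>x. clifford_conj (Y k i x) \<odot> (clifford_vec x \<odot> Y k' i' x))"
  define w where "w = (\<lambda>t. P k N t * Q k' N' t)"
  have Y: "Y k i \<in> spherical_monogenics k" "Y k' i' \<in> spherical_monogenics k'"
    using assms(4) i i' unfolding orthonormal_monogenic_basis_def Let_def by blast+
  then have C1: "continuously_differentiable (Y k i)" "continuously_differentiable (Y k' i')"
    unfolding spherical_monogenics_def
    using homogeneous_polynomial_imp_continuously_differentiable by blast+
  have monogenic: "dirac (Y k i) x = 0" "dirac (Y k' i') x = 0" for x
    using Y unfolding spherical_monogenics_def by blast+
  have "smooth_on_unit_interval (P k N)" "smooth_on_unit_interval (Q k' N')"
    using assms(5)[OF i] assms(6)[OF i']
    unfolding enumerates_eigen_profiles_def eigen_profile_def by blast+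
  then have cont_w: "continuous_on {0..1} w"
    unfolding w_def by (intro continuous_intros smooth_on_unit_interval_imp_continuous_on)
  have cont_W: "continuous_on UNIV W"
    unfolding W_def using C1 by (rule continuous_on_conj_vec_mult)
  have integrand: "clifford_conj (even_cpswf (P k) (Y k i) N x) \<odot> odd_cpswf (Q k') (Y k' i') N' x =
      w ((norm x)\<^sup>2) *\<^sub>R W x" for x
    unfolding even_cpswf_def odd_cpswf_def radial_multiple_def vec_multiple_def w_def W_def
    by (simp add: linear_scale[OF linear_clifford_conj] clifford_mult_linear mult.commute)
  have "continuous_on (cball 0 1) (\<lambda>x::'n point. w ((norm x)\<^sup>2))"
    by (rule continuous_on_compose2[OF cont_w]) (auto intro!: continuous_intros power_le_one)
  then have "continuous_on (cball 0 1) (\<lambda>x. w ((norm x)\<^sup>2) *\<^sub>R W x)"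
    by (intro continuous_intros continuous_on_subset[OF cont_W]) auto
  then have integrable: "set_integrable lborel (ball 0 1)
      (\<lambda>x. (1 - (norm x)\<^sup>2) powr \<alpha> *\<^sub>R (w ((norm x)\<^sup>2) *\<^sub>R W x))"
    using assms(3) by (rule set_integrable_ball_weight_mult[rotated])
  \<comment> \<open>The profiles are controlled on \<open>[0,1]\<close> only, so the radial weight is cut off there; leaving out \<open>1\<close>
    turns the closed ball into the open one.\<close>
  define v where "v = (\<lambda>r. (1 - r\<^sup>2) powr \<alpha> * (indicator {0..<1} r * w (r\<^sup>2)))"
  have "continuous_on {0..<1} (\<lambda>r. w (r\<^sup>2))"
    by (rule continuous_on_compose2[OF cont_w]) (auto intro!: continuous_intros power_le_one)
  from borel_measurable_continuous_on_indicator[OF _ this]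
  have "(\<lambda>r. indicator {0..<1} r * w (r\<^sup>2)) \<in> borel_measurable borel" by simp
  then have "v \<in> borel_measurable borel"
    unfolding v_def by (intro borel_measurable_times[of "\<lambda>r. (1 - r\<^sup>2) powr \<alpha>"]) auto
  from monogenic_integral_radial_eq_0[OF C1(1) monogenic(1) C1(2) monogenic(2) this]
  have "(\<integral>x. indicator (cball 0 1) x *\<^sub>R (v (norm x) *\<^sub>R W x) \<partial>lborel) = 0"
    by (simp add: W_def)
  moreover have "indicator (cball 0 1) x *\<^sub>R (v (norm x) *\<^sub>R W x) =
      indicator (ball 0 1) x *\<^sub>R ((1 - (norm x)\<^sup>2) powr \<alpha> *\<^sub>R (w ((norm x)\<^sup>2) *\<^sub>R W x))" for x
    by (auto simp: v_def indicator_def)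
  ultimately have "(LINT x:ball 0 1|lborel. (1 - (norm x)\<^sup>2) powr \<alpha> *\<^sub>R (w ((norm x)\<^sup>2) *\<^sub>R W x)) = 0"
    unfolding set_lebesgue_integral_def by (simp only:)
  with integrable show "set_integrable lborel (ball 0 1)
      (\<lambda>x. (1 - (norm x)\<^sup>2) powr \<alpha> *\<^sub>R
        (clifford_conj (even_cpswf (P k) (Y k i) N x) \<odot> odd_cpswf (Q k') (Y k' i') N' x)) \<and>
    (LINT x:ball 0 1|lborel. (1 - (norm x)\<^sup>2) powr \<alpha> *\<^sub>R
        (clifford_conj (even_cpswf (P k) (Y k i) N x) \<odot> odd_cpswf (Q k') (Y k' i') N' x)) = 0"
    unfolding integrand by blast
qed

end
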